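(* Let $G=(V,E)$ be a connected simple graph with $n\geq 2$ vertices and $m$ edges. Then for every vertex $v_i\in V$, $$\mathcal{RE}_G(v_i)\leq \frac{d_i}{2m}+\sqrt{\left(\frac{1}{d_i}\sum_{j:\, v_j\sim v_i}\frac{1}{d_j}-\frac{d_i}{2m}\right)\left(1-\frac{d_i}{2m}\right)}.$$ Equality holds if $G\cong K_n$, and equality also holds if $G\cong S_n$ with $v_i$ its center.
   Context: All graphs are finite and simple. For a graph $G$ with vertices $v_1,\dots,v_n$, let $d_i$ be the degree of $v_i$; $v_j\sim v_i$ means that $v_j$ and $v_i$ are adjacent. The Randić matrix $R(G)=(R_{ij})$ is the real symmetric $n\times n$ matrix with $R_{ij}=\frac{1}{\sqrt{d_id_j}}$ if $v_i\sim v_j$ and $R_{ij}=0$ otherwise. Put $|R(G)|=(R(G)R(G)^* )^{1/2}$ (positive semidefinite square root). The Randić energy of the vertex $v_i$ is $\mathcal{RE}_G(v_i)=|R(G)|_{ii}$, the $i$-th diagonal entry of $|R(G)|$. $K_n$ is the complete graph on $n$ vertices; $S_n=K_{1,n-1}$ is the star graph on $n$ vertices, whose center is the vertex adjacent to all others (for $n=2$, either vertex). *)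

theory Defs
  imports "Graph_Theory.Graph_Theory" "Jordan_Normal_Form.Schur_Decomposition"
begin

text \<open>
  A finite simple graph is a \<^locale>\<open>pair_graph\<close>: finite vertex set, symmetric irreflexive arc
  relation, so that an undirected edge is represented by two opposite arcs. An enumeration
  \<open>v\<^sub>1, \<dots>, v\<^sub>n\<close> of the vertices is a distinct list \<open>vs\<close> with \<open>set vs = pverts G\<close>, indexed from 0.
\<close>

text \<open>The arc relation being symmetric, the degree of a vertex is its out-degree.\<close>

definition deg :: "'a pair_pre_digraph \<Rightarrow> 'a \<Rightarrow> nat" where
  "deg G v = out_degree (with_proj G) v"

text \<open>Undirected edges are counted as unordered pairs, i.e. not twice.\<close>

definition edges :: "'a pair_pre_digraph \<Rightarrow> 'a set set" where
  "edges G = {{u, v} | u v. (u, v) \<in> parcs G}"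

definition randic_matrix :: "'a pair_pre_digraph \<Rightarrow> 'a list \<Rightarrow> real mat" where
  "randic_matrix G vs = mat (length vs) (length vs)
     (\<lambda>(i, j). if (vs ! i, vs ! j) \<in> parcs G
               then 1 / sqrt (real (deg G (vs ! i)) * real (deg G (vs ! j))) else 0)"

text \<open>On \<^typ>\<open>real\<close>, \<^const>\<open>conjugate\<close> is the identity, so \<^const>\<open>mat_adjoint\<close> is the transpose.\<close>

lemma mat_adjoint_real: "mat_adjoint (A :: real mat) = transpose_mat A"
  by (rule eq_matI) (auto simp: mat_adjoint_def mat_of_rows_def)

definition pos_semidef :: "real mat \<Rightarrow> bool" where
  "pos_semidef A \<longleftrightarrow> square_mat A \<and> mat_adjoint A = A \<and>
     (\<forall>x \<in> carrier_vec (dim_row A). 0 \<le> x \<bullet> (A *\<^sub>v x))"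

text \<open>
  The positive semidefinite square root; it exists and is unique whenever \<open>A\<close> is itself
  positive semidefinite, in particular for \<open>A A\<^sup>*\<close>.
\<close>

definition psd_sqrt :: "real mat \<Rightarrow> real mat" where
  "psd_sqrt A = (THE B. pos_semidef B \<and> B * B = A)"

definition abs_mat :: "real mat \<Rightarrow> real mat" where
  "abs_mat A = psd_sqrt (A * mat_adjoint A)"

definition randic_vertex_energy :: "'a pair_pre_digraph \<Rightarrow> 'a list \<Rightarrow> nat \<Rightarrow> real" where
  "randic_vertex_energy G vs i = abs_mat (randic_matrix G vs) $$ (i, i)"

text \<open>
  The library predicates \<^const>\<open>complete_digraph\<close> and \<^const>\<open>complete_bipartite_digraph\<close> describe
  graphs up to isomorphism; \<open>G \<cong> S\<^sub>n\<close> means that \<open>G\<close> is a \<open>K\<^bsub>1,n-1\<^esub>\<close>.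
\<close>

definition is_star :: "nat \<Rightarrow> 'a pair_pre_digraph \<Rightarrow> bool" where
  "is_star n G \<longleftrightarrow> complete_bipartite_digraph 1 (n - 1) (with_proj G)"

definition is_center :: "'a pair_pre_digraph \<Rightarrow> 'a \<Rightarrow> bool" where
  "is_center G v \<longleftrightarrow> v \<in> pverts G \<and> (\<forall>w \<in> pverts G - {v}. (v, w) \<in> parcs G)"

end

theory Submission
  imports Defs "Jordan_Normal_Form.Spectral_Radius"
begin

text \<open>
  Write \<open>R\<close> for the Randic matrix, \<open>B = |R|\<close>, and \<open>e\<close> for the \<open>i\<close>-th unit vector, so that the
  energy of \<open>v\<^sub>i\<close> is \<open>B\<^sub>i\<^sub>i = e \<bullet> B e\<close>. The vector \<open>u\<close> with entries \<open>sqrt (d\<^sub>j / 2m)\<close> is fixed by \<open>R\<close>,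
  and it is a unit vector because the degrees add up to \<open>2m\<close>. Since \<open>B\<close> is positive semidefinite and
  \<open>B\<^sup>2 = R\<^sup>2\<close>, also \<open>B u = u\<close>. Split \<open>e = u\<^sub>i u + w\<close> with \<open>w\<close> orthogonal to \<open>u\<close>. As \<open>B\<close> is symmetric
  and fixes \<open>u\<close>, the mixed terms vanish and Cauchy--Schwarz gives

  \<open>B\<^sub>i\<^sub>i = u\<^sub>i\<^sup>2 + w \<bullet> B w \<le> u\<^sub>i\<^sup>2 + |B w| |w|\<close>.

  Here \<open>u\<^sub>i\<^sup>2 = d\<^sub>i / 2m\<close>, \<open>|w|\<^sup>2 = 1 - u\<^sub>i\<^sup>2\<close>, and \<open>|B w|\<^sup>2 = |B e|\<^sup>2 - u\<^sub>i\<^sup>2\<close> where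
  \<open>|B e|\<^sup>2 = (R\<^sup>2)\<^sub>i\<^sub>i\<close> is the sum of \<open>1 / (d\<^sub>i d\<^sub>j)\<close> over the neighbours \<open>v\<^sub>j\<close> of \<open>v\<^sub>i\<close>. This is the bound;
  the matrix part is \<open>pos_semidef_diagonal_entry\<close>.

  Equality holds as soon as \<open>B w = c w\<close> with \<open>c \<ge> 0\<close>, and for this \<open>R\<^sup>2 w = c\<^sup>2 w\<close> is enough. For \<open>K\<^sub>n\<close>
  the matrix \<open>R\<close> acts as \<open>-1 / (n - 1)\<close> on the orthogonal complement of \<open>u\<close>. For the center of
  a star, \<open>R\<close> sends \<open>e\<close> to a multiple of the sum of the unit vectors of the leaves and back to \<open>e\<close>,
  hence \<open>R\<^sup>2 w = w\<close>.

  Both passages from \<open>B\<^sup>2\<close> to \<open>B\<close> rest on \<open>pos_semidef_eigenvector_of_square\<close>: a positive semidefinite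
  matrix \<open>B\<close> satisfies \<open>B x = c x\<close> whenever \<open>B\<^sup>2 x = c\<^sup>2 x\<close> and \<open>c \<ge> 0\<close>. That \<open>|R|\<close> is what its definite
  description promises needs existence and uniqueness of the positive semidefinite square root. They
  follow from the spectral theorem for real symmetric matrices, obtained by splitting off one
  eigenvector at a time with a Householder reflection.
\<close>

section \<open>Real symmetric matrices are orthogonally diagonalizable\<close>

lemma mult_unit_vec_eq_col:
  fixes A :: "'a :: semiring_1 mat"
  assumes "A \<in> carrier_mat n m" "j < m"
  shows "A *\<^sub>v unit_vec m j = col A j"
  using assms by (intro eq_vecI) auto

lemma eq_mat_on_vecI:
  fixes A B :: "'a :: semiring_1 mat"
  assumes "A \<in> carrier_mat n m" "B \<in> carrier_mat n m"
    and "\<And>x. x \<in> carrier_vec m \<Longrightarrow> A *\<^sub>v x = B *\<^sub>v x"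
  shows "A = B"
proof (rule mat_col_eqI)
  fix j assume "j < dim_col B"
  then have "j < m" using assms(2) by simp
  then have "A *\<^sub>v unit_vec m j = col A j" "B *\<^sub>v unit_vec m j = col B j"
    using mult_unit_vec_eq_col assms(1,2) by blast+
  then show "col A j = col B j" using assms(3)[of "unit_vec m j"] by simp
qed (use assms in auto)

lemma scalar_prod_mult_symmetric:
  fixes A :: "real mat"
  assumes "A \<in> carrier_mat n n" "transpose_mat A = A" "x \<in> carrier_vec n" "y \<in> carrier_vec n"
  shows "x \<bullet> (A *\<^sub>v y) = (A *\<^sub>v x) \<bullet> y"
  using transpose_vec_mult_scalar[of A n n y x] assms by simp

lemma scalar_prod_self_nonneg: "0 \<le> (x :: real vec) \<bullet> x"
  by (auto simp: scalar_prod_def intro!: sum_nonneg)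

lemma scalar_prod_self_eq_0:
  "(x :: real vec) \<in> carrier_vec n \<Longrightarrow> x \<bullet> x = 0 \<longleftrightarrow> x = 0\<^sub>v n"
  by (auto simp: scalar_prod_def sum_nonneg_eq_0_iff)

text \<open>
  Over the complex numbers some eigenvector \<open>z = x + \<i> y\<close> exists. Comparing \<open>x \<bullet> A y\<close> with
  \<open>A x \<bullet> y\<close> shows that the imaginary part of its eigenvalue, times \<open>|x|\<^sup>2 + |y|\<^sup>2\<close>, is zero. So the
  eigenvalue is real, and whichever of \<open>x\<close> and \<open>y\<close> is nonzero is a real eigenvector.
\<close>

lemma symmetric_real_eigenvector:
  fixes A :: "real mat"
  assumes A: "A \<in> carrier_mat n n" and sym: "transpose_mat A = A" and n: "0 < n"
  obtains e v where "v \<in> carrier_vec n" "v \<noteq> 0\<^sub>v n" "A *\<^sub>v v = e \<cdot>\<^sub>v v"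
proof -
  let ?C = "map_mat complex_of_real A"
  have C: "?C \<in> carrier_mat n n" using A by simp
  obtain \<mu> z where z: "z \<in> carrier_vec n" "z \<noteq> 0\<^sub>v n" and ev: "?C *\<^sub>v z = \<mu> \<cdot>\<^sub>v z"
    using spectrum_non_empty[OF C n] A by (auto simp: spectrum_def eigenvalue_def eigenvector_def)
  define x y where "x = map_vec Re z" and "y = map_vec Im z"
  have xy: "x \<in> carrier_vec n" "y \<in> carrier_vec n" using z by (auto simp: x_def y_def)
  have comp: "(\<Sum>k = 0..<n. of_real (A $$ (j, k)) * z $ k) = \<mu> * z $ j" if "j < n" for j
  proof -
    have "(?C *\<^sub>v z) $ j = (\<mu> \<cdot>\<^sub>v z) $ j" using ev by simp
    then show ?thesis using that A z by (simp add: scalar_prod_def)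
  qed
  have Ax: "A *\<^sub>v x = Re \<mu> \<cdot>\<^sub>v x - Im \<mu> \<cdot>\<^sub>v y"
  proof (rule eq_vecI)
    fix j assume "j < dim_vec (Re \<mu> \<cdot>\<^sub>v x - Im \<mu> \<cdot>\<^sub>v y)"
    then have j: "j < n" using xy by simp
    show "(A *\<^sub>v x) $ j = (Re \<mu> \<cdot>\<^sub>v x - Im \<mu> \<cdot>\<^sub>v y) $ j"
      using arg_cong[OF comp[OF j], of Re] j A z by (simp add: x_def y_def scalar_prod_def)
  qed (use A xy in auto)
  have Ay: "A *\<^sub>v y = Im \<mu> \<cdot>\<^sub>v x + Re \<mu> \<cdot>\<^sub>v y"
  proof (rule eq_vecI)
    fix j assume "j < dim_vec (Im \<mu> \<cdot>\<^sub>v x + Re \<mu> \<cdot>\<^sub>v y)"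
    then have j: "j < n" using xy by simp
    show "(A *\<^sub>v y) $ j = (Im \<mu> \<cdot>\<^sub>v x + Re \<mu> \<cdot>\<^sub>v y) $ j"
      using arg_cong[OF comp[OF j], of Im] j A z by (simp add: x_def y_def scalar_prod_def)
  qed (use A xy in auto)
  have nz: "x \<noteq> 0\<^sub>v n \<or> y \<noteq> 0\<^sub>v n"
  proof (rule ccontr)
    assume "\<not> ?thesis"
    then have "Re (z $ j) = 0 \<and> Im (z $ j) = 0" if "j < n" for j
      using that z by (metis carrier_vecD index_map_vec(1) index_zero_vec(1) x_def y_def)
    then show False using z by (auto simp: complex_eq_iff intro!: eq_vecI)
  qed
  have "Im \<mu> * (x \<bullet> x + y \<bullet> y) = 0"
  proof -
    have "x \<bullet> (A *\<^sub>v y) = (A *\<^sub>v x) \<bullet> y" by (rule scalar_prod_mult_symmetric[OF A sym xy])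
    then show ?thesis unfolding Ax Ay using xy
      by (simp add: scalar_prod_add_distrib[of _ n] minus_scalar_prod_distrib[of _ n] algebra_simps)
  qed
  moreover have "x \<bullet> x + y \<bullet> y \<noteq> 0"
    using nz scalar_prod_self_eq_0[OF xy(1)] scalar_prod_self_eq_0[OF xy(2)]
      scalar_prod_self_nonneg[of x] scalar_prod_self_nonneg[of y] by linarith
  ultimately have im: "Im \<mu> = 0" by simp
  have "A *\<^sub>v x = Re \<mu> \<cdot>\<^sub>v x" "A *\<^sub>v y = Re \<mu> \<cdot>\<^sub>v y"
    using Ax Ay im xy by (auto intro!: eq_vecI)
  then show ?thesis using nz xy that by blast
qed

text \<open>
  The reflection in the hyperplane that bisects \<open>v\<close> and the first unit vector exchanges the two. It
  extends \<open>v\<close> to an orthonormal basis, namely its columns, and is its own inverse and transpose.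
\<close>

lemma householder_reflection:
  fixes v :: "real vec"
  assumes v: "v \<in> carrier_vec n" and unit: "v \<bullet> v = 1" and n: "0 < n"
  obtains H where "H \<in> carrier_mat n n" "transpose_mat H = H" "H * H = 1\<^sub>m n"
    "H *\<^sub>v unit_vec n 0 = v"
proof -
  define w where "w = unit_vec n 0 - v"
  have w: "w \<in> carrier_vec n" using v by (simp add: w_def)
  \<comment> \<open>The reflection along \<open>w\<close> is \<open>x \<mapsto> x - (2 (w \<bullet> x) / |w|\<^sup>2) w\<close>; it degenerates to the identity
      when \<open>v\<close> is the first unit vector.\<close>
  define c where "c = 2 / (w \<bullet> w)"
  have ww: "w \<bullet> w = 2 - 2 * v $ 0"
    unfolding w_def using v n unit
    by (simp add: scalar_prod_minus_distrib[of _ n] minus_scalar_prod_distrib[of _ n])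
  have ew: "w \<bullet> unit_vec n 0 = 1 - v $ 0" using v n by (simp add: w_def)
  show ?thesis
  proof (cases "w \<bullet> w = 0")
    case True
    then have w0: "w = 0\<^sub>v n" using scalar_prod_self_eq_0[OF w] by simp
    have "v = unit_vec n 0"
    proof (rule eq_vecI)
      fix j assume "j < dim_vec (unit_vec n 0 :: real vec)"
      then have j: "j < n" by simp
      have "w $ j = 0" using w0 j by simp
      then show "v $ j = unit_vec n 0 $ j" using j v by (simp add: w_def)
    qed (use v in auto)
    then show ?thesis using that[of "1\<^sub>m n"] by simp
  next
    case False
    define H where "H = mat n n (\<lambda>(i, j). (if i = j then 1 else 0) - c * w $ i * w $ j)"
    have H: "H \<in> carrier_mat n n" by (simp add: H_def)
    have Hx: "H *\<^sub>v x = x - (c * (w \<bullet> x)) \<cdot>\<^sub>v w" if x: "x \<in> carrier_vec n" for x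
    proof (rule eq_vecI)
      fix j assume "j < dim_vec (x - (c * (w \<bullet> x)) \<cdot>\<^sub>v w)"
      then have j: "j < n" using w by simp
      have "(H *\<^sub>v x) $ j = (\<Sum>k = 0..<n. (if j = k then x $ k else 0) - c * w $ j * (w $ k * x $ k))"
        using j x by (auto simp: H_def scalar_prod_def algebra_simps intro!: sum.cong)
      also have "\<dots> = x $ j - c * w $ j * (w \<bullet> x)"
        using j x by (simp add: sum_subtractf sum_distrib_left scalar_prod_def)
      finally show "(H *\<^sub>v x) $ j = (x - (c * (w \<bullet> x)) \<cdot>\<^sub>v w) $ j"
        using j x w by (simp add: algebra_simps)
    qed (use w H in auto)
    have "H * H = 1\<^sub>m n"
    proof (rule eq_mat_on_vecI[of _ n n])
      fix x :: "real vec" assume x: "x \<in> carrier_vec n"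
      have wHx: "w \<bullet> (H *\<^sub>v x) = - (w \<bullet> x)"
        unfolding Hx[OF x] using False w x
        by (simp add: scalar_prod_minus_distrib[of _ n] c_def)
      have "(H * H) *\<^sub>v x = H *\<^sub>v (H *\<^sub>v x)" using H x by simp
      also have "\<dots> = H *\<^sub>v x - (c * (w \<bullet> (H *\<^sub>v x))) \<cdot>\<^sub>v w" using H x by (intro Hx) simp
      also have "\<dots> = x" unfolding wHx unfolding Hx[OF x] using w x by (intro eq_vecI) auto
      finally show "(H * H) *\<^sub>v x = 1\<^sub>m n *\<^sub>v x" using x by simp
    qed (use H in auto)
    moreover have "transpose_mat H = H" by (rule eq_matI) (auto simp: H_def)
    moreover have "H *\<^sub>v unit_vec n 0 = v"
    proof -
      have "c * (w \<bullet> unit_vec n 0) = 1" using False ww ew by (simp add: c_def field_simps)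
      then show ?thesis using Hx[of "unit_vec n 0"] v by (intro eq_vecI) (auto simp: w_def)
    qed
    ultimately show ?thesis using that H by blast
  qed
qed

text \<open>
  A reflection \<open>H\<close> whose first column is a unit eigenvector turns \<open>A\<close> into \<open>H A H\<close>, whose first column
  is a multiple of the first unit vector. By symmetry so is its first row, and the remaining block is
  a smaller symmetric matrix.
\<close>

lemma symmetric_real_diagonalization:
  fixes A :: "real mat"
  assumes "A \<in> carrier_mat n n" and "transpose_mat A = A"
  shows "\<exists>P D. P \<in> carrier_mat n n \<and> D \<in> carrier_mat n n \<and> diagonal_mat D \<and>
    transpose_mat P * P = 1\<^sub>m n \<and> A = P * D * transpose_mat P"
  using assms
proof (induction n arbitrary: A)
  case 0
  then show ?case
    by (intro exI[of _ "1\<^sub>m 0"] exI[of _ "1\<^sub>m 0"]) (auto simp: diagonal_mat_def)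
next
  case (Suc n A)
  note A = Suc.prems(1) and sym = Suc.prems(2)
  let ?n = "Suc n"
  obtain e v0 where v0: "v0 \<in> carrier_vec ?n" "v0 \<noteq> 0\<^sub>v ?n" "A *\<^sub>v v0 = e \<cdot>\<^sub>v v0"
    using symmetric_real_eigenvector[OF A sym] by blast
  define v where "v = (1 / sqrt (v0 \<bullet> v0)) \<cdot>\<^sub>v v0"
  have v: "v \<in> carrier_vec ?n" using v0 by (simp add: v_def)
  have pos: "0 < v0 \<bullet> v0"
    using scalar_prod_self_nonneg[of v0] scalar_prod_self_eq_0[OF v0(1)] v0(2) by linarith
  have unit: "v \<bullet> v = 1" using v0 pos by (simp add: v_def field_simps)
  have Av: "A *\<^sub>v v = e \<cdot>\<^sub>v v"
    unfolding v_def mult_mat_vec[OF A v0(1)] v0(3) by (simp add: smult_smult_assoc mult.commute)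
  obtain H where H: "H \<in> carrier_mat ?n ?n" "transpose_mat H = H" "H * H = 1\<^sub>m ?n"
    "H *\<^sub>v unit_vec ?n 0 = v"
    using householder_reflection[OF v unit] by blast
  define A' where "A' = H * A * H"
  have A': "A' \<in> carrier_mat ?n ?n" using H A by (simp add: A'_def)
  have A'sym: "transpose_mat A' = A'"
    unfolding A'_def using H A sym
    by (simp add: transpose_mult[of _ ?n ?n _ ?n] assoc_mult_mat[of _ ?n ?n _ ?n _ ?n])
  have Hv: "H *\<^sub>v v = unit_vec ?n 0"
  proof -
    have "H *\<^sub>v v = (H * H) *\<^sub>v unit_vec ?n 0"
      unfolding H(4)[symmetric] using H(1) by (intro assoc_mult_mat_vec[symmetric]) auto
    then show ?thesis using H by simp
  qed
  have "A' *\<^sub>v unit_vec ?n 0 = e \<cdot>\<^sub>v unit_vec ?n 0"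
  proof -
    have "A' *\<^sub>v unit_vec ?n 0 = H *\<^sub>v (A *\<^sub>v (H *\<^sub>v unit_vec ?n 0))"
      unfolding A'_def using H(1) A by (simp add: assoc_mult_mat_vec[of _ ?n ?n _ ?n])
    then show ?thesis using H v Av Hv by (simp add: mult_mat_vec[of _ ?n ?n])
  qed
  then have colA': "col A' 0 = e \<cdot>\<^sub>v unit_vec ?n 0"
    using mult_unit_vec_eq_col[OF A', of 0] by simp
  have A'0: "A' $$ (j, 0) = (if j = 0 then e else 0)" if "j < ?n" for j
    using arg_cong[OF colA', of "\<lambda>x. x $ j"] that A' by simp
  have swap: "A' $$ (j, k) = A' $$ (k, j)" if "j < ?n" "k < ?n" for j k
    using arg_cong[OF A'sym, of "\<lambda>M. M $$ (j, k)"] that A' by simp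
  have A'0': "A' $$ (0, j) = (if j = 0 then e else 0)" if "j < ?n" for j
    using A'0[OF that] swap[of 0 j] that by simp
  define A3 where "A3 = mat n n (\<lambda>(i, j). A' $$ (Suc i, Suc j))"
  let ?E = "mat 1 1 (\<lambda>_. e)"
  let ?z = "0\<^sub>m 1 n :: real mat" and ?z' = "0\<^sub>m n 1 :: real mat"
  have A'block: "A' = four_block_mat ?E ?z ?z' A3"
    by (rule eq_matI) (use A' A'0 A'0' in \<open>auto simp: A3_def\<close>)
  have "transpose_mat A3 = A3"
    by (intro eq_matI) (auto simp: A3_def swap)
  then obtain P D where P: "P \<in> carrier_mat n n" and D: "D \<in> carrier_mat n n"
    and diag: "diagonal_mat D" and PP: "transpose_mat P * P = 1\<^sub>m n"
    and A3: "A3 = P * D * transpose_mat P"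
    using Suc.IH[of A3] by (auto simp: A3_def)
  define P' where "P' = four_block_mat (1\<^sub>m 1) ?z ?z' P"
  define D' where "D' = four_block_mat ?E ?z ?z' D"
  have P': "P' \<in> carrier_mat ?n ?n" and D': "D' \<in> carrier_mat ?n ?n"
    using P D by (auto simp: P'_def D'_def)
  have P't: "transpose_mat P' = four_block_mat (1\<^sub>m 1) ?z ?z' (transpose_mat P)"
    unfolding P'_def using P by (subst transpose_four_block_mat[of _ 1 1 _ n _ n]) auto
  have P'P': "transpose_mat P' * P' = 1\<^sub>m ?n"
    unfolding P't unfolding P'_def using P PP
    by (subst mult_four_block_mat[of _ 1 1 _ n _ n _ _ 1 _ n]) auto
  have A'dec: "A' = P' * D' * transpose_mat P'"
    unfolding P't unfolding P'_def D'_def A'block A3 using P D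
    by (simp add: mult_four_block_mat[of _ 1 1 _ n _ n _ _ 1 _ n])
  have "transpose_mat (H * P') * (H * P') = transpose_mat P' * ((H * H) * P')"
    using H(1,2) P' by (simp add: transpose_mult[of _ ?n ?n _ ?n] assoc_mult_mat[of _ ?n ?n _ ?n _ ?n])
  then have orth: "transpose_mat (H * P') * (H * P') = 1\<^sub>m ?n" using H P' P'P' by simp
  have "A = (H * H) * A * (H * H)" using H(3) A by simp
  also have "\<dots> = H * A' * H"
    unfolding A'_def using H(1) A by (simp add: assoc_mult_mat[of _ ?n ?n _ ?n _ ?n])
  also have "\<dots> = (H * P') * D' * transpose_mat (H * P')"
    unfolding A'dec using H(1,2) P' D'
    by (simp add: transpose_mult[of _ ?n ?n _ ?n] assoc_mult_mat[of _ ?n ?n _ ?n _ ?n])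
  finally have "A = (H * P') * D' * transpose_mat (H * P')" .
  moreover have "diagonal_mat D'"
    using diag D by (auto simp: diagonal_mat_def D'_def)
  ultimately show ?case using orth H(1) P' D' by (intro exI[of _ "H * P'"] exI[of _ D']) auto
qed

section \<open>Positive semidefinite square roots\<close>

lemma Cauchy_Schwarz_vec:
  fixes x y :: "real vec"
  assumes x: "x \<in> carrier_vec n" and y: "y \<in> carrier_vec n"
  shows "(x \<bullet> y)\<^sup>2 \<le> (x \<bullet> x) * (y \<bullet> y)"
proof (cases "x \<bullet> x = 0")
  case True
  then have "x = 0\<^sub>v n" using scalar_prod_self_eq_0[OF x] by simp
  then show ?thesis using y by simp
next
  case False
  then have pos: "0 < x \<bullet> x" using scalar_prod_self_nonneg[of x] by linarith
  define z where "z = (x \<bullet> x) \<cdot>\<^sub>v y - (x \<bullet> y) \<cdot>\<^sub>v x"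
  have "0 \<le> z \<bullet> z" by (rule scalar_prod_self_nonneg)
  also have "z \<bullet> z = (x \<bullet> x) * ((x \<bullet> x) * (y \<bullet> y) - (x \<bullet> y)\<^sup>2)"
    unfolding z_def using x y comm_scalar_prod[OF x y]
    by (simp add: scalar_prod_minus_distrib[of _ n] minus_scalar_prod_distrib[of _ n]
        power2_eq_square algebra_simps)
  finally show ?thesis using pos by (simp add: zero_le_mult_iff)
qed

lemma pos_semidefD:
  assumes "pos_semidef B" "B \<in> carrier_mat n n"
  shows "transpose_mat B = B" "\<And>x. x \<in> carrier_vec n \<Longrightarrow> 0 \<le> x \<bullet> (B *\<^sub>v x)"
  using assms by (auto simp: pos_semidef_def mat_adjoint_real)

lemma carrier_mat_of_square:
  assumes "pos_semidef B" "B * B \<in> carrier_mat n n"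
  shows "B \<in> carrier_mat n n"
proof -
  have "dim_row B = n" using assms(2) by (metis carrier_matD(1) index_mult_mat(2))
  then show ?thesis using assms(1) by (auto simp: pos_semidef_def)
qed

text \<open>
  Put \<open>y = B x - c x\<close>. The hypothesis says \<open>(B + c) y = 0\<close>, so \<open>y\<close> would be an eigenvector of \<open>B\<close> for
  \<open>-c\<close>, which is impossible for \<open>c > 0\<close> unless \<open>y = 0\<close>. For \<open>c = 0\<close> use \<open>|B x|\<^sup>2 = x \<bullet> B\<^sup>2 x\<close>.
\<close>

lemma pos_semidef_eigenvector_of_square:
  fixes B :: "real mat"
  assumes psd: "pos_semidef B" and B: "B \<in> carrier_mat n n" and x: "x \<in> carrier_vec n"
    and c: "0 \<le> c" and sq: "B *\<^sub>v (B *\<^sub>v x) = c\<^sup>2 \<cdot>\<^sub>v x"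
  shows "B *\<^sub>v x = c \<cdot>\<^sub>v x"
proof (cases "c = 0")
  case True
  have "(B *\<^sub>v x) \<bullet> (B *\<^sub>v x) = x \<bullet> (B *\<^sub>v (B *\<^sub>v x))"
    using scalar_prod_mult_symmetric[OF B pos_semidefD(1)[OF psd B], of x "B *\<^sub>v x"] x B by simp
  also have "\<dots> = 0" unfolding sq using True x by simp
  finally have "B *\<^sub>v x = 0\<^sub>v n" using scalar_prod_self_eq_0[of "B *\<^sub>v x" n] B x by simp
  then show ?thesis using True x by (intro eq_vecI) auto
next
  case False
  define y where "y = B *\<^sub>v x - c \<cdot>\<^sub>v x"
  have y: "y \<in> carrier_vec n" using B x by (simp add: y_def)
  have "B *\<^sub>v y = B *\<^sub>v (B *\<^sub>v x) - B *\<^sub>v (c \<cdot>\<^sub>v x)"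
    unfolding y_def using B x by (intro mult_minus_distrib_mat_vec[of _ n n]) auto
  also have "\<dots> = c\<^sup>2 \<cdot>\<^sub>v x - c \<cdot>\<^sub>v (B *\<^sub>v x)"
    unfolding sq mult_mat_vec[OF B x] ..
  also have "\<dots> = (- c) \<cdot>\<^sub>v y"
    unfolding y_def using B x by (intro eq_vecI) (auto simp: power2_eq_square algebra_simps)
  finally have By: "B *\<^sub>v y = (- c) \<cdot>\<^sub>v y" .
  have "0 \<le> - c * (y \<bullet> y)" using pos_semidefD(2)[OF psd B y] unfolding By using y by simp
  then have "y \<bullet> y = 0"
    using False c scalar_prod_self_nonneg[of y] by (simp add: mult_le_0_iff)
  then have y0: "y = 0\<^sub>v n" using scalar_prod_self_eq_0[OF y] by simp
  show ?thesis
  proof (rule eq_vecI)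
    fix j assume "j < dim_vec (c \<cdot>\<^sub>v x)"
    then show "(B *\<^sub>v x) $ j = (c \<cdot>\<^sub>v x) $ j"
      using arg_cong[OF y0, of "\<lambda>z. z $ j"] B x by (simp add: y_def)
  qed (use B x in auto)
qed

lemma diagonal_mat_mult_vec:
  fixes D :: "'a :: comm_ring_1 mat"
  assumes "diagonal_mat D" "D \<in> carrier_mat n n" "x \<in> carrier_vec n" "j < n"
  shows "(D *\<^sub>v x) $ j = D $$ (j, j) * x $ j"
proof -
  have "(D *\<^sub>v x) $ j = (\<Sum>k = 0..<n. D $$ (j, k) * x $ k)"
    using assms by (simp add: scalar_prod_def)
  also have "\<dots> = (\<Sum>k = 0..<n. if k = j then D $$ (j, j) * x $ j else 0)"
    using assms by (intro sum.cong) (auto simp: diagonal_mat_def)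
  finally show ?thesis using assms by simp
qed

text \<open>
  With \<open>A = P D P\<^sup>T\<close>, taking square roots of the diagonal gives the square root \<open>P S P\<^sup>T\<close>. Any other
  positive semidefinite square root must scale each column of \<open>P\<close>, an eigenvector of \<open>A\<close>, by the square
  root of its eigenvalue, and therefore agrees with it on a basis.
\<close>

lemma pos_semidef_sqrt_unique_exists:
  fixes A :: "real mat"
  assumes psd: "pos_semidef A" and A: "A \<in> carrier_mat n n"
  shows "\<exists>!B. pos_semidef B \<and> B * B = A"
proof -
  obtain P D where P: "P \<in> carrier_mat n n" and D: "D \<in> carrier_mat n n"
    and diag: "diagonal_mat D" and PtP: "transpose_mat P * P = 1\<^sub>m n"
    and dec: "A = P * D * transpose_mat P"
    using symmetric_real_diagonalization[OF A pos_semidefD(1)[OF psd A]] by blast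
  \<comment> \<open>Taking roots of all entries keeps the matrix diagonal because \<open>sqrt 0 = 0\<close>.\<close>
  define S where "S = map_mat sqrt D"
  have S: "S \<in> carrier_mat n n" using D by (simp add: S_def)
  have S_diag: "diagonal_mat S" using diag by (simp add: S_def diagonal_mat_def)
  have S_entry: "S $$ (j, j) = sqrt (D $$ (j, j))" if "j < n" for j
    using that D by (simp add: S_def)
  have S_sym: "transpose_mat S = S"
  proof (rule eq_matI)
    fix i j assume "i < dim_row S" "j < dim_col S"
    then show "transpose_mat S $$ (i, j) = S $$ (i, j)"
      using S S_diag by (cases "i = j") (auto simp: diagonal_mat_def)
  qed (use S in auto)
  have Pt: "transpose_mat P \<in> carrier_mat n n" using P by simp
  have PPt: "P * transpose_mat P = 1\<^sub>m n" by (rule mat_mult_left_right_inverse[OF Pt P PtP])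
  have unit_D: "D *\<^sub>v unit_vec n j = D $$ (j, j) \<cdot>\<^sub>v unit_vec n j" if "j < n" for j
    using that D by (intro eq_vecI) (simp_all add: diagonal_mat_mult_vec[OF diag D] del: index_mult_mat_vec)
  have unit_S: "S *\<^sub>v unit_vec n j = sqrt (D $$ (j, j)) \<cdot>\<^sub>v unit_vec n j" if "j < n" for j
    using that S S_entry
    by (intro eq_vecI) (simp_all add: diagonal_mat_mult_vec[OF S_diag S] del: index_mult_mat_vec)
  have A_col: "A *\<^sub>v (P *\<^sub>v unit_vec n j) = D $$ (j, j) \<cdot>\<^sub>v (P *\<^sub>v unit_vec n j)" if "j < n" for j
  proof -
    have "A *\<^sub>v (P *\<^sub>v unit_vec n j) = P *\<^sub>v (D *\<^sub>v ((transpose_mat P * P) *\<^sub>v unit_vec n j))"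
      unfolding dec using P D by (simp add: assoc_mult_mat_vec[of _ n n _ n] del: PtP)
    then show ?thesis unfolding PtP using unit_D[OF that] mult_mat_vec[OF P] by simp
  qed
  have D_nonneg: "0 \<le> D $$ (j, j)" if "j < n" for j
  proof -
    let ?p = "P *\<^sub>v unit_vec n j"
    have p: "?p \<in> carrier_vec n" using P by simp
    have "?p \<bullet> ?p = (transpose_mat P *\<^sub>v ?p) \<bullet> unit_vec n j"
      using transpose_vec_mult_scalar[OF P unit_vec_carrier p] by simp
    also have "transpose_mat P *\<^sub>v ?p = unit_vec n j"
      using assoc_mult_mat_vec[OF Pt P unit_vec_carrier, of j] PtP by simp
    finally have "?p \<bullet> ?p = 1" using that by simp
    then show ?thesis using pos_semidefD(2)[OF psd A p] A_col[OF that] p by simp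
  qed
  define B where "B = P * S * transpose_mat P"
  have B: "B \<in> carrier_mat n n" using P S by (simp add: B_def)
  have SS: "S * S = D"
  proof (rule eq_mat_on_vecI[of _ n n])
    fix x :: "real vec" assume x: "x \<in> carrier_vec n"
    show "(S * S) *\<^sub>v x = D *\<^sub>v x"
    proof (rule eq_vecI)
      fix j assume "j < dim_vec (D *\<^sub>v x)"
      then have j: "j < n" using D by simp
      have "((S * S) *\<^sub>v x) $ j = (S *\<^sub>v (S *\<^sub>v x)) $ j"
        using assoc_mult_mat_vec[OF S S x] by simp
      also have "\<dots> = S $$ (j, j) * (S $$ (j, j) * x $ j)"
        using diagonal_mat_mult_vec[OF S_diag S _ j] S x by (simp del: index_mult_mat_vec)
      also have "\<dots> = (D *\<^sub>v x) $ j"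
        unfolding diagonal_mat_mult_vec[OF diag D x j] using D_nonneg[OF j] j D
        by (simp add: S_def mult.assoc[symmetric])
      finally show "((S * S) *\<^sub>v x) $ j = (D *\<^sub>v x) $ j" .
    qed (use S D in auto)
  qed (use S D in auto)
  have "B * B = P * (S * ((transpose_mat P * P) * S)) * transpose_mat P"
    unfolding B_def using P S by (simp add: assoc_mult_mat[of _ n n _ n _ n])
  also have "\<dots> = A" unfolding PtP dec using S SS by simp
  finally have BB: "B * B = A" .
  have B_psd: "pos_semidef B"
    unfolding pos_semidef_def mat_adjoint_real
  proof (intro conjI ballI)
    show "square_mat B" using B by simp
    show "transpose_mat B = B"
      unfolding B_def using P S S_sym
      by (simp add: transpose_mult[of _ n n _ n] assoc_mult_mat[of _ n n _ n _ n])
    fix x :: "real vec" assume "x \<in> carrier_vec (dim_row B)"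
    then have x: "x \<in> carrier_vec n" using B by simp
    let ?y = "transpose_mat P *\<^sub>v x"
    have y: "?y \<in> carrier_vec n" using P x by simp
    have "B *\<^sub>v x = P *\<^sub>v (S *\<^sub>v ?y)"
      unfolding B_def using P S x by (simp add: assoc_mult_mat_vec[of _ n n _ n])
    then have "x \<bullet> (B *\<^sub>v x) = ?y \<bullet> (S *\<^sub>v ?y)"
      using transpose_vec_mult_scalar[OF P _ x, of "S *\<^sub>v ?y"] S y by simp
    also have "\<dots> = (\<Sum>j = 0..<n. S $$ (j, j) * (?y $ j)\<^sup>2)"
      using S y by (auto simp: scalar_prod_def[of ?y] power2_eq_square
          diagonal_mat_mult_vec[OF S_diag S y] simp del: index_mult_mat_vec intro!: sum.cong)
    also have "\<dots> \<ge> 0" using D D_nonneg by (auto intro!: sum_nonneg simp: S_def)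
    finally show "0 \<le> x \<bullet> (B *\<^sub>v x)" .
  qed
  have "B' = B" if psd': "pos_semidef B'" and sq: "B' * B' = A" for B'
  proof -
    have B': "B' \<in> carrier_mat n n"
      using carrier_mat_of_square[OF psd'] sq A by simp
    have "B' * P = P * S"
    proof (rule mat_col_eqI)
      fix j assume "j < dim_col (P * S)"
      then have j: "j < n" using S by simp
      let ?p = "P *\<^sub>v unit_vec n j"
      have p: "?p \<in> carrier_vec n" using P by simp
      have "B' *\<^sub>v (B' *\<^sub>v ?p) = (sqrt (D $$ (j, j)))\<^sup>2 \<cdot>\<^sub>v ?p"
        using assoc_mult_mat_vec[OF B' B' p] sq A_col[OF j] D_nonneg[OF j] by simp
      then have "B' *\<^sub>v ?p = sqrt (D $$ (j, j)) \<cdot>\<^sub>v ?p"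
        using D_nonneg[OF j] by (intro pos_semidef_eigenvector_of_square[OF psd' B' p]) auto
      also have "\<dots> = P *\<^sub>v (S *\<^sub>v unit_vec n j)"
        unfolding unit_S[OF j] mult_mat_vec[OF P unit_vec_carrier] ..
      finally have "(B' * P) *\<^sub>v unit_vec n j = (P * S) *\<^sub>v unit_vec n j"
        using B' P S by (simp add: assoc_mult_mat_vec[of _ n n _ n])
      then show "col (B' * P) j = col (P * S) j"
        using mult_unit_vec_eq_col[of "B' * P" n n j] mult_unit_vec_eq_col[of "P * S" n n j] B' P S j
        by simp
    qed (use B' P S in auto)
    then have "B' * (P * transpose_mat P) = B"
      unfolding B_def using assoc_mult_mat[OF B' P Pt] by simp
    then show ?thesis unfolding PPt using B' by simp
  qed
  then show ?thesis using B_psd BB by blast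
qed

lemma abs_mat_characterization:
  fixes A :: "real mat"
  assumes A: "A \<in> carrier_mat n n"
  shows "pos_semidef (abs_mat A)" "abs_mat A * abs_mat A = A * transpose_mat A"
    "abs_mat A \<in> carrier_mat n n"
proof -
  have AA: "A * transpose_mat A \<in> carrier_mat n n" using A by simp
  have psd: "pos_semidef (A * transpose_mat A)"
    unfolding pos_semidef_def mat_adjoint_real
  proof (intro conjI ballI)
    show "square_mat (A * transpose_mat A)" by simp
    show "transpose_mat (A * transpose_mat A) = A * transpose_mat A"
      using A by (simp add: transpose_mult[of _ n n _ n])
    fix x :: "real vec" assume "x \<in> carrier_vec (dim_row (A * transpose_mat A))"
    then have x: "x \<in> carrier_vec n" using A by simp
    have "x \<bullet> ((A * transpose_mat A) *\<^sub>v x) = (transpose_mat A *\<^sub>v x) \<bullet> (transpose_mat A *\<^sub>v x)"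
      using transpose_vec_mult_scalar[OF A _ x, of "transpose_mat A *\<^sub>v x"] A x
      by (simp add: assoc_mult_mat_vec[of _ n n _ n])
    then show "0 \<le> x \<bullet> ((A * transpose_mat A) *\<^sub>v x)" by (simp add: scalar_prod_self_nonneg)
  qed
  have "pos_semidef (abs_mat A) \<and> abs_mat A * abs_mat A = A * transpose_mat A"
    unfolding abs_mat_def psd_sqrt_def mat_adjoint_real
    by (rule theI'[OF pos_semidef_sqrt_unique_exists[OF psd AA]])
  then show *: "pos_semidef (abs_mat A)" "abs_mat A * abs_mat A = A * transpose_mat A" by auto
  show "abs_mat A \<in> carrier_mat n n"
    using carrier_mat_of_square[OF *(1)] *(2) AA by simp
qed

section \<open>Bounding a diagonal entry by means of a fixed vector\<close>

text \<open>
  The vector \<open>w\<close> is the component of the unit vector orthogonal to \<open>u\<close>. The bound is Cauchy--Schwarz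
  for \<open>w\<close> and \<open>B w\<close>, hence an equality when these two are parallel in the same direction.
\<close>

lemma pos_semidef_diagonal_entry:
  fixes B :: "real mat"
  assumes psd: "pos_semidef B" and B: "B \<in> carrier_mat n n"
    and u: "u \<in> carrier_vec n" and unit: "u \<bullet> u = 1" and fix_u: "(B * B) *\<^sub>v u = u" and i: "i < n"
  defines "bound \<equiv> (u $ i)\<^sup>2 + sqrt (((B * B) $$ (i, i) - (u $ i)\<^sup>2) * (1 - (u $ i)\<^sup>2))"
    and "w \<equiv> unit_vec n i - (u $ i) \<cdot>\<^sub>v u"
  shows "B $$ (i, i) \<le> bound"
    and "0 \<le> c \<Longrightarrow> (B * B) *\<^sub>v w = c\<^sup>2 \<cdot>\<^sub>v w \<Longrightarrow> B $$ (i, i) = bound"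
proof -
  let ?e = "unit_vec n i"
  note sym = scalar_prod_mult_symmetric[OF B pos_semidefD(1)[OF psd B]]
  have w: "w \<in> carrier_vec n" using u by (simp add: w_def)
  have Bu: "B *\<^sub>v u = u"
    using pos_semidef_eigenvector_of_square[OF psd B u, of 1] fix_u assoc_mult_mat_vec[OF B B u] by simp
  have Bw: "B *\<^sub>v w \<in> carrier_vec n" "B *\<^sub>v ?e \<in> carrier_vec n" using B w by auto
  have Bw_eq: "B *\<^sub>v w = B *\<^sub>v ?e - (u $ i) \<cdot>\<^sub>v u"
    unfolding w_def using mult_minus_distrib_mat_vec[OF B, of ?e "(u $ i) \<cdot>\<^sub>v u"] mult_mat_vec[OF B u] u Bu
    by simp
  have uBe: "u \<bullet> (B *\<^sub>v ?e) = u $ i" using sym[OF u, of ?e] Bu u i by simp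
  have eBe: "?e \<bullet> (B *\<^sub>v ?e) = B $$ (i, i)" using B i by simp
  have BeBe: "(B *\<^sub>v ?e) \<bullet> (B *\<^sub>v ?e) = (B * B) $$ (i, i)"
  proof -
    have "(B *\<^sub>v ?e) \<bullet> (B *\<^sub>v ?e) = ?e \<bullet> ((B * B) *\<^sub>v ?e)"
      using sym[of ?e "B *\<^sub>v ?e"] Bw assoc_mult_mat_vec[OF B B, of ?e] by simp
    then show ?thesis using B i by (simp add: mult_unit_vec_eq_col[of _ n n])
  qed
  have ww: "w \<bullet> w = 1 - (u $ i)\<^sup>2"
    unfolding w_def using u i unit
    by (simp add: scalar_prod_minus_distrib[of _ n] minus_scalar_prod_distrib[of _ n] power2_eq_square)
  have BwBw: "(B *\<^sub>v w) \<bullet> (B *\<^sub>v w) = (B * B) $$ (i, i) - (u $ i)\<^sup>2"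
    unfolding Bw_eq using u unit uBe Bw(2) BeBe comm_scalar_prod[OF u Bw(2)]
    by (simp add: scalar_prod_minus_distrib[of _ n] minus_scalar_prod_distrib[of _ n] power2_eq_square
        del: index_mult_mat index_mult_mat_vec)
  have wBw: "w \<bullet> (B *\<^sub>v w) = B $$ (i, i) - (u $ i)\<^sup>2"
    unfolding Bw_eq unfolding w_def using u unit uBe eBe Bw(2) i
    by (simp add: scalar_prod_minus_distrib[of _ n] minus_scalar_prod_distrib[of _ n] power2_eq_square
        del: index_mult_mat_vec)
  have bound: "bound = (u $ i)\<^sup>2 + sqrt (((B *\<^sub>v w) \<bullet> (B *\<^sub>v w)) * (w \<bullet> w))"
    unfolding bound_def BwBw ww ..
  have "w \<bullet> (B *\<^sub>v w) \<le> sqrt (((B *\<^sub>v w) \<bullet> (B *\<^sub>v w)) * (w \<bullet> w))"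
    using Cauchy_Schwarz_vec[OF w Bw(1)] by (intro real_le_rsqrt) (simp add: mult.commute)
  then show "B $$ (i, i) \<le> bound" unfolding bound wBw by simp
  assume c: "0 \<le> c" and "(B * B) *\<^sub>v w = c\<^sup>2 \<cdot>\<^sub>v w"
  then have "B *\<^sub>v w = c \<cdot>\<^sub>v w"
    using assoc_mult_mat_vec[OF B B w] by (intro pos_semidef_eigenvector_of_square[OF psd B w]) auto
  then have "w \<bullet> (B *\<^sub>v w) = c * (w \<bullet> w)" "(B *\<^sub>v w) \<bullet> (B *\<^sub>v w) * (w \<bullet> w) = (c * (w \<bullet> w))\<^sup>2"
    using w by (simp_all add: power2_eq_square)
  then show "B $$ (i, i) = bound"
    unfolding bound using c scalar_prod_self_nonneg[of w] wBw by simp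
qed

section \<open>The Randic matrix of a connected graph\<close>

text \<open>
  Both sides count arcs: each edge carries two opposite arcs, and these differ for want of loops.
\<close>

lemma (in pair_graph) sum_deg_eq_twice_edges:
  "(\<Sum>v \<in> pverts G. deg G v) = 2 * card (edges G)"
proof -
  have edges: "edges G = (\<lambda>(u, v). {u, v}) ` parcs G"
    by (auto simp: edges_def)
  have fibre: "card {a \<in> parcs G. (\<lambda>(u, v). {u, v}) a = e} = 2" if e_edge: "e \<in> edges G" for e
  proof -
    obtain u v where uv: "(u, v) \<in> parcs G" and e: "e = {u, v}"
      using e_edge by (auto simp: edges_def)
    have "{a \<in> parcs G. (\<lambda>(u, v). {u, v}) a = e} = {(u, v), (v, u)}"
    proof (intro equalityI subsetI)
      fix a assume a: "a \<in> {a \<in> parcs G. (\<lambda>(u, v). {u, v}) a = e}"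
      obtain x y where xy: "a = (x, y)" by (cases a)
      then have "{x, y} = {u, v}" using a e by simp
      then show "a \<in> {(u, v), (v, u)}" unfolding xy doubleton_eq_iff by blast
    next
      fix a assume "a \<in> {(u, v), (v, u)}"
      then show "a \<in> {a \<in> parcs G. (\<lambda>(u, v). {u, v}) a = e}"
        using uv arcs_symmetric[OF uv] insert_commute[of u v "{}"] by (elim insertE) (simp_all add: e)
    qed
    then show ?thesis using no_loops'[OF uv] by simp
  qed
  have "(\<Sum>v \<in> pverts G. deg G v) = (\<Sum>v \<in> pverts G. \<Sum>a \<in> {a \<in> parcs G. fst a = v}. 1)"
    by (simp add: deg_def out_degree_def out_arcs_def)
  also have "\<dots> = (\<Sum>a \<in> parcs G. 1)"
    using pair_finite_arcs pair_finite_verts in_arcsD1 by (intro sum.group) auto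
  also have "\<dots> = (\<Sum>e \<in> edges G. \<Sum>a \<in> {a \<in> parcs G. (\<lambda>(u, v). {u, v}) a = e}. 1)"
    using pair_finite_arcs by (intro sum.group[symmetric]) (auto simp: edges)
  also have "\<dots> = (\<Sum>e \<in> edges G. 2)"
    using fibre by (intro sum.cong) auto
  finally show ?thesis by simp
qed

lemma (in pair_graph) deg_pos_if_connected:
  assumes con: "Digraph_Component.connected (with_proj G)" and two: "2 \<le> card (pverts G)"
    and v: "v \<in> pverts G"
  shows "0 < deg G v"
proof -
  have "strongly_connected (with_proj G)"
    using symmetric_connected_imp_strongly_connected[OF _ con] pair_sym_arcs by simp
  have "\<not> pverts G \<subseteq> {v}"
    using two card_mono[of "{v}" "pverts G"] by auto
  then obtain w where w: "w \<in> pverts G" "w \<noteq> v" by blast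
  have "v \<rightarrow>\<^sup>*\<^bsub>with_proj G\<^esub> w"
    using \<open>strongly_connected (with_proj G)\<close> v w by (auto simp: strongly_connected_def)
  then have "(v, w) \<in> (parcs G)\<^sup>*"
    unfolding reachable_def by (auto dest: rtrancl_on_rtranclI)
  then obtain x where "(v, x) \<in> parcs G" using w(2) by (metis converse_rtranclE)
  then have "(v, x) \<in> {a \<in> parcs G. fst a = v}" by simp
  then show ?thesis
    using pair_finite_arcs by (auto simp: deg_def out_degree_def out_arcs_def card_gt_0_iff)
qed

text \<open>
  Vertices are addressed by their position in \<open>vs\<close>, because these positions index the matrix.
\<close>

locale enumerated_connected_graph = pair_graph G for G :: "'a pair_pre_digraph" +
  fixes vs :: "'a list"
  assumes connected: "Digraph_Component.connected (with_proj G)"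
    and distinct: "distinct vs" and set_vs: "set vs = pverts G"
    and two_vertices: "2 \<le> length vs"
begin

abbreviation n :: nat where "n \<equiv> length vs"
abbreviation m :: nat where "m \<equiv> card (edges G)"
abbreviation adj :: "nat \<Rightarrow> nat \<Rightarrow> bool" where "adj j k \<equiv> (vs ! j, vs ! k) \<in> parcs G"
abbreviation d :: "nat \<Rightarrow> real" where "d j \<equiv> real (deg G (vs ! j))"
abbreviation R :: "real mat" where "R \<equiv> randic_matrix G vs"

text \<open>
  The entrywise square root of the stationary distribution of the simple random walk, which makes it
  a unit eigenvector of the Randic matrix for the eigenvalue 1.
\<close>

definition u :: "real vec" where "u = vec n (\<lambda>j. sqrt (d j / (2 * real m)))"

lemma card_verts: "card (pverts G) = n"
  using distinct set_vs distinct_card by metis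

lemma d_pos: "j < n \<Longrightarrow> 0 < d j"
  using deg_pos_if_connected[OF connected _ nth_mem[of j vs, unfolded set_vs]] two_vertices
  by (simp add: card_verts)

lemma sum_d: "(\<Sum>j = 0..<n. d j) = 2 * real m"
proof -
  have "(\<Sum>j = 0..<n. deg G (vs ! j)) = (\<Sum>v \<in> pverts G. deg G v)"
    using bij_betw_nth[OF distinct refl set_vs[symmetric]]
    by (intro sum.reindex_bij_betw) (simp add: atLeast0LessThan)
  then show ?thesis using sum_deg_eq_twice_edges by (simp flip: of_nat_sum)
qed

lemma m_pos: "0 < real m"
proof -
  have "0 < (\<Sum>j = 0..<n. d j)" using d_pos two_vertices by (intro sum_pos) auto
  then show ?thesis using sum_d by simp
qed

lemma d_eq_card: "d j = real (card {k. k < n \<and> adj j k})"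
proof -
  have "inj_on (\<lambda>k. (vs ! j, vs ! k)) {k. k < n \<and> adj j k}"
    using distinct by (auto simp: inj_on_def nth_eq_iff_index_eq)
  moreover have "(\<lambda>k. (vs ! j, vs ! k)) ` {k. k < n \<and> adj j k} = {a \<in> parcs G. fst a = vs ! j}"
  proof (intro equalityI subsetI)
    fix a assume a: "a \<in> {a \<in> parcs G. fst a = vs ! j}"
    then have "snd a \<in> set vs" using arc_snd_in_verts set_vs by auto
    then obtain k where k: "k < n" "vs ! k = snd a" by (auto simp: in_set_conv_nth)
    then have "a = (vs ! j, vs ! k)" using a by (simp add: prod_eq_iff)
    then show "a \<in> (\<lambda>k. (vs ! j, vs ! k)) ` {k. k < n \<and> adj j k}"
      using a k(1) by blast
  qed auto
  ultimately show ?thesis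
    by (simp add: deg_def out_degree_def out_arcs_def card_image flip: card_image)
qed

lemma R_carrier: "R \<in> carrier_mat n n"
  by (simp add: randic_matrix_def)

lemma R_index: "j < n \<Longrightarrow> k < n \<Longrightarrow> R $$ (j, k) = (if adj j k then 1 / sqrt (d j * d k) else 0)"
  by (simp add: randic_matrix_def)

lemma R_symmetric: "transpose_mat R = R"
  using arcs_symmetric R_carrier by (intro eq_matI) (auto simp: R_index mult.commute)

lemma u_carrier: "u \<in> carrier_vec n"
  by (simp add: u_def)

lemma u_index_square: "j < n \<Longrightarrow> (u $ j)\<^sup>2 = d j / (2 * real m)"
  by (simp add: u_def)

lemma u_unit: "u \<bullet> u = 1"
proof -
  have "u \<bullet> u = (\<Sum>j = 0..<n. d j / (2 * real m))"
    unfolding scalar_prod_def using u_carrier u_index_square by (simp add: power2_eq_square)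
  then show ?thesis using sum_d m_pos by (simp flip: sum_divide_distrib)
qed

text \<open>
  The weight \<open>sqrt d\<^sub>k\<close> of a neighbour cancels, so that each of the \<open>d\<^sub>j\<close> neighbours of \<open>v\<^sub>j\<close> contributes
  the same amount \<open>1 / sqrt (2 m d\<^sub>j)\<close>.
\<close>

lemma R_mult_u: "R *\<^sub>v u = u"
proof (rule eq_vecI)
  fix j assume "j < dim_vec u"
  then have j: "j < n" using u_carrier by simp
  have "(R *\<^sub>v u) $ j = (\<Sum>k = 0..<n. R $$ (j, k) * u $ k)"
    using j R_carrier u_carrier by (simp add: scalar_prod_def)
  also have "\<dots> = (\<Sum>k = 0..<n. if adj j k then 1 / (sqrt (d j) * sqrt (2 * real m)) else 0)"
  proof (rule sum.cong)
    fix k assume "k \<in> {0..<n}"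
    then have k: "k < n" by simp
    have "R $$ (j, k) * u $ k
      = (if adj j k then 1 / (sqrt (d j) * sqrt (d k)) * (sqrt (d k) / sqrt (2 * real m)) else 0)"
      by (simp add: R_index[OF j k] u_def k real_sqrt_mult real_sqrt_divide)
    then show "R $$ (j, k) * u $ k = (if adj j k then 1 / (sqrt (d j) * sqrt (2 * real m)) else 0)"
      using d_pos[OF k] by simp
  qed simp
  also have "\<dots> = d j / (sqrt (d j) * sqrt (2 * real m))"
    by (simp add: d_eq_card[of j] sum.If_cases Int_def)
  also have "\<dots> = u $ j"
    using real_div_sqrt[of "d j"] d_pos[OF j] j
    by (simp add: u_def real_sqrt_divide real_sqrt_mult flip: divide_divide_eq_left)
  finally show "(R *\<^sub>v u) $ j = u $ j" .
qed (use R_carrier u_carrier in simp)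

lemma R_square_diagonal:
  assumes i: "i < n"
  shows "(R * R) $$ (i, i) = 1 / d i * (\<Sum>j | j < n \<and> adj j i. 1 / d j)"
proof -
  have "(R * R) $$ (i, i) = (\<Sum>j = 0..<n. R $$ (i, j) * R $$ (j, i))"
    using i R_carrier by (simp add: scalar_prod_def)
  also have "\<dots> = (\<Sum>j = 0..<n. if adj j i then 1 / d i * (1 / d j) else 0)"
    using i arcs_symmetric by (intro sum.cong) (auto simp: R_index mult.commute)
  also have "\<dots> = (\<Sum>j | j < n \<and> adj j i. 1 / d i * (1 / d j))"
    by (simp add: sum.If_cases Int_def)
  finally show ?thesis by (simp add: sum_distrib_left)
qed

definition bound :: "nat \<Rightarrow> real" where
  "bound i = d i / (2 * real m)
     + sqrt ((1 / d i * (\<Sum>j | j < n \<and> adj j i. 1 / d j) - d i / (2 * real m))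
       * (1 - d i / (2 * real m)))"

lemma RR_mult: "x \<in> carrier_vec n \<Longrightarrow> (R * R) *\<^sub>v x = R *\<^sub>v (R *\<^sub>v x)"
  using assoc_mult_mat_vec[OF R_carrier R_carrier] .

section \<open>The energy bound and its equality cases\<close>

lemma
  assumes i: "i < n"
  shows energy_le_bound: "randic_vertex_energy G vs i \<le> bound i"
    and energy_eq_boundI: "\<And>c. 0 \<le> c \<Longrightarrow>
      R *\<^sub>v (R *\<^sub>v (unit_vec n i - u $ i \<cdot>\<^sub>v u)) = c\<^sup>2 \<cdot>\<^sub>v (unit_vec n i - u $ i \<cdot>\<^sub>v u)
      \<Longrightarrow> randic_vertex_energy G vs i = bound i"
proof -
  note abs_R = abs_mat_characterization[OF R_carrier, unfolded R_symmetric]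
  have "(R * R) *\<^sub>v u = u" using RR_mult[OF u_carrier] R_mult_u by simp
  note entry = pos_semidef_diagonal_entry[OF abs_R(1,3) u_carrier u_unit _ i,
      unfolded abs_R(2) u_index_square[OF i] R_square_diagonal[OF i],
      OF this, folded bound_def randic_vertex_energy_def]
  show "randic_vertex_energy G vs i \<le> bound i" by (rule entry(1))
  fix c :: real
  assume "0 \<le> c"
    "R *\<^sub>v (R *\<^sub>v (unit_vec n i - u $ i \<cdot>\<^sub>v u)) = c\<^sup>2 \<cdot>\<^sub>v (unit_vec n i - u $ i \<cdot>\<^sub>v u)"
  then show "randic_vertex_energy G vs i = bound i"
    using RR_mult[of "unit_vec n i - u $ i \<cdot>\<^sub>v u"] u_carrier by (intro entry(2)[of c]) auto
qed

text \<open>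
  All off-diagonal entries of \<open>R\<close> are \<open>1 / (n - 1)\<close>, and \<open>u\<close> is constant. The entries of \<open>w\<close> therefore
  add up to 0, and row \<open>j\<close> of \<open>R w\<close>, which sums all entries but the \<open>j\<close>-th, is \<open>-w\<^sub>j / (n - 1)\<close>.
\<close>

lemma energy_complete:
  assumes complete: "complete_digraph n (with_proj G)" and i: "i < n"
  shows "randic_vertex_energy G vs i = bound i"
proof -
  have adj: "adj j k \<longleftrightarrow> j \<noteq> k" if "j < n" "k < n" for j k
    using complete that distinct set_vs nth_mem unfolding complete_digraph_pair_def
    by (auto simp: nth_eq_iff_index_eq)
  have d: "d j = real n - 1" if "j < n" for j
  proof -
    have "{k. k < n \<and> adj j k} = {0..<n} - {j}" using adj that by auto
    then show ?thesis using that by (simp add: d_eq_card)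
  qed
  have m: "2 * real m = real n * (real n - 1)"
    using sum_d d by simp
  have n1: "0 < real n - 1" using two_vertices by simp
  have u_entry: "u $ j = 1 / sqrt (real n)" if "j < n" for j
    using that n1 by (simp add: u_def d m real_sqrt_divide real_sqrt_mult)
  define w where "w = unit_vec n i - u $ i \<cdot>\<^sub>v u"
  define s where "s = - 1 / (real n - 1)"
  have w: "w \<in> carrier_vec n" using u_carrier by (simp add: w_def)
  have w_entry: "w $ j = (if j = i then 1 else 0) - 1 / real n" if "j < n" for j
    using that i u_carrier by (simp add: w_def u_entry)
  have w_sum: "(\<Sum>j = 0..<n. w $ j) = 0"
    using i by (auto simp: w_entry sum_subtractf)
  have "R *\<^sub>v w = s \<cdot>\<^sub>v w"
  proof (rule eq_vecI)
    fix j assume "j < dim_vec (s \<cdot>\<^sub>v w)"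
    then have j: "j < n" using w by simp
    have "(R *\<^sub>v w) $ j = (\<Sum>k = 0..<n. R $$ (j, k) * w $ k)"
      using j R_carrier w by (simp add: scalar_prod_def)
    also have "\<dots> = (\<Sum>k = 0..<n. s * ((if k = j then w $ j else 0) - w $ k))"
      using j adj n1 by (intro sum.cong) (auto simp: R_index d s_def)
    also have "\<dots> = s * w $ j"
      using j w_sum by (simp add: sum_subtractf flip: sum_distrib_left)
    finally show "(R *\<^sub>v w) $ j = (s \<cdot>\<^sub>v w) $ j" using j w by simp
  qed (use R_carrier w in auto)
  then have "R *\<^sub>v (R *\<^sub>v w) = (1 / (real n - 1))\<^sup>2 \<cdot>\<^sub>v w"
    using mult_mat_vec[OF R_carrier w, of s] by (simp add: smult_smult_assoc s_def power2_eq_square)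
  then show ?thesis
    using energy_eq_boundI[OF i, of "1 / (real n - 1)"] n1 by (simp add: w_def)
qed

text \<open>
  A vertex adjacent to all others is alone in its part of the bipartition. That part need not be the
  first one: for \<open>n = 2\<close> both parts are singletons.
\<close>

lemma star_adjacency:
  assumes star: "is_star n G" and center: "is_center G (vs ! i)" and i: "i < n"
    and j: "j < n" and k: "k < n"
  shows "adj j k \<longleftrightarrow> (j = i) \<noteq> (k = i)"
proof -
  let ?c = "vs ! i"
  obtain U V where UV: "pverts G = U \<union> V" "U \<inter> V = {}" "card U = 1" "card V = n - 1"
    and arcs: "parcs G = U \<times> V \<union> V \<times> U"
    using star unfolding is_star_def complete_bipartite_digraph_pair_def by blast
  have c: "?c \<in> pverts G" "\<And>x. x \<in> pverts G \<Longrightarrow> x \<noteq> ?c \<Longrightarrow> (?c, x) \<in> parcs G"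
    using center by (auto simp: is_center_def)
  have "U = {?c} \<or> V = {?c}"
  proof (cases "?c \<in> U")
    case True
    then show ?thesis using UV(3) by (metis card_1_singletonE singletonD)
  next
    case False
    then have "?c \<in> V" using c(1) UV(1) by blast
    moreover have "x = ?c" if "x \<in> V" for x
      using c(2)[of x] that False UV(1,2) arcs by auto
    ultimately show ?thesis by blast
  qed
  then have "(x, y) \<in> parcs G \<longleftrightarrow> (x = ?c) \<noteq> (y = ?c)"
    if "x \<in> pverts G" "y \<in> pverts G" for x y
  proof
    assume "U = {?c}"
    then show ?thesis using that UV(1,2) unfolding arcs by auto
  next
    assume "V = {?c}"
    then show ?thesis using that UV(1,2) unfolding arcs by auto
  qed
  moreover have "vs ! j \<in> pverts G" "vs ! k \<in> pverts G"
    using j k set_vs nth_mem by blast+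
  ultimately show ?thesis
    using nth_eq_iff_index_eq[OF distinct] i j k by simp
qed

text \<open>
  Walks of length two from the center return to it, and their total weight is \<open>(n - 1) / (n - 1) = 1\<close>.
  So \<open>R\<^sup>2\<close> fixes the unit vector of the center as well as \<open>u\<close>, and hence \<open>w\<close>.
\<close>

lemma energy_star_center:
  assumes star: "is_star n G" and center: "is_center G (vs ! i)" and i: "i < n"
  shows "randic_vertex_energy G vs i = bound i"
proof -
  note adj = star_adjacency[OF star center i]
  have d_i: "d i = real n - 1"
  proof -
    have "{k. k < n \<and> adj i k} = {0..<n} - {i}" using adj i by auto
    then show ?thesis using i by (simp add: d_eq_card)
  qed
  have d_leaf: "d j = 1" if "j < n" "j \<noteq> i" for j
  proof -
    have "{k. k < n \<and> adj j k} = {i}" using adj i that by auto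
    then show ?thesis by (simp add: d_eq_card)
  qed
  have n1: "0 < real n - 1" using two_vertices by simp
  let ?e = "unit_vec n i :: real vec"
  have "R *\<^sub>v (R *\<^sub>v ?e) = ?e"
  proof (rule eq_vecI)
    fix j assume "j < dim_vec ?e"
    then have j: "j < n" by simp
    have "(R *\<^sub>v (R *\<^sub>v ?e)) $ j = (\<Sum>k = 0..<n. R $$ (j, k) * R $$ (k, i))"
      using j i R_carrier by (simp add: mult_unit_vec_eq_col[OF R_carrier] scalar_prod_def)
    also have "\<dots> = (\<Sum>k = 0..<n. if j = i \<and> k \<noteq> i then 1 / (real n - 1) else 0)"
      using j i adj n1 by (intro sum.cong) (auto simp: R_index d_i d_leaf)
    also have "\<dots> = ?e $ j"
    proof (cases "j = i")
      case True
      have "{0..<n} \<inter> {k. k \<noteq> i} = {0..<n} - {i}" by auto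
      then show ?thesis using True i n1 by (simp add: sum.If_cases)
    qed (use i j in simp)
    finally show "(R *\<^sub>v (R *\<^sub>v ?e)) $ j = ?e $ j" .
  qed (use R_carrier in simp)
  moreover have "R *\<^sub>v (R *\<^sub>v (u $ i \<cdot>\<^sub>v u)) = u $ i \<cdot>\<^sub>v u"
    by (simp add: mult_mat_vec[OF R_carrier u_carrier] R_mult_u)
  moreover have "R *\<^sub>v (R *\<^sub>v (?e - u $ i \<cdot>\<^sub>v u))
    = R *\<^sub>v (R *\<^sub>v ?e) - R *\<^sub>v (R *\<^sub>v (u $ i \<cdot>\<^sub>v u))"
    using R_carrier u_carrier by (simp add: mult_minus_distrib_mat_vec[of _ n n])
  ultimately show ?thesis
    using energy_eq_boundI[OF i, of 1] u_carrier by simp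
qed

end

theorem theorem3p6:
  fixes G :: "'a pair_pre_digraph" and vs :: "'a list" and n m i :: nat and d :: "nat \<Rightarrow> real"
  assumes "pair_graph G"
    and "Digraph_Component.connected (with_proj G)"
    and "distinct vs" and "set vs = pverts G"
    and "n = card (pverts G)" and "n \<ge> 2"
    and "m = card (edges G)"
    and "\<And>j. j < n \<Longrightarrow> d j = real (deg G (vs ! j))"
    and "i < n"
  shows "let bound = d i / (2 * real m)
            + sqrt ((1 / d i * (\<Sum>j | j < n \<and> (vs ! j, vs ! i) \<in> parcs G. 1 / d j)
                       - d i / (2 * real m)) * (1 - d i / (2 * real m)))
         in randic_vertex_energy G vs i \<le> bound
            \<and> (complete_digraph n (with_proj G) \<longrightarrow> randic_vertex_energy G vs i = bound)
            \<and> (is_star n G \<and> is_center G (vs ! i) \<longrightarrow> randic_vertex_energy G vs i = bound)"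
proof -
  have n: "n = length vs" using distinct_card[OF assms(3)] assms(4,5) by simp
  interpret pair_graph G by fact
  interpret enumerated_connected_graph G vs
  proof unfold_locales
    show "2 \<le> length vs" using assms(6) unfolding n .
  qed (fact assms(2-4))+
  have "(\<Sum>j | j < n \<and> (vs ! j, vs ! i) \<in> parcs G. 1 / d j)
      = (\<Sum>j | j < n \<and> (vs ! j, vs ! i) \<in> parcs G. 1 / real (deg G (vs ! j)))"
    using assms(8) by (intro sum.cong) auto
  then have "d i / (2 * real m)
      + sqrt ((1 / d i * (\<Sum>j | j < n \<and> (vs ! j, vs ! i) \<in> parcs G. 1 / d j)
        - d i / (2 * real m)) * (1 - d i / (2 * real m))) = bound i"
    unfolding bound_def assms(7) assms(8)[OF assms(9)] n by simp
  moreover have "i < length vs" using assms(9) unfolding n .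
  ultimately show ?thesis
    using energy_le_bound energy_complete energy_star_center unfolding Let_def n by simp
qed

end
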